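(* Let $\mathcal{P}$ be the set of multigraphs on $[n]$ that contain an induced simple $(n-1)$-cycle. Then a.a.s. no strategy in the pre-positional process produces a multigraph in $\mathcal{P}$, whereas there is a strategy in the post-positional process that a.a.s. constructs a multigraph in $\mathcal{P}$ in $O(n\log n)$ rounds.
   Context: Semi-random graph processes on $[n]$: $G_0$ is the empty multigraph; in round $t$, $u_t$ is uniform on $[n]$, the player chooses $v_t$, and the edge $u_tv_t$ is added (loops and multiple edges are allowed and kept). Post-positional: $v_t$ may depend on the history and on $u_t$. Pre-positional: $v_t$ depends only on the history, not on $u_t$. An induced simple $(n-1)$-cycle is a set $S$ of $n-1$ vertices such that the underlying simple graph induced on $S$ is a cycle of length $n-1$. A.a.s. means with probability tending to $1$ as $n\to\infty$. *)

theory Defs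
  imports "HOL-Probability.Probability" "HOL-Library.Landau_Symbols"
begin

text \<open>Edges are sets \<open>{u, v}\<close>, a loop being the singleton \<open>{u}\<close>; a multigraph on a
  fixed vertex set is the finite multiset of its edges.\<close>

type_synonym multigraph = "nat set multiset"

definition multigraph_on :: "nat set \<Rightarrow> multigraph \<Rightarrow> bool" where
  "multigraph_on V G \<longleftrightarrow> (\<forall>e\<in>#G. \<exists>u\<in>V. \<exists>v\<in>V. e = {u, v})"

definition simple_edges :: "multigraph \<Rightarrow> nat set set" where
  "simple_edges G = {e \<in> set_mset G. card e = 2}"

definition induced_edges :: "nat set \<Rightarrow> nat set set \<Rightarrow> nat set set" where
  "induced_edges S E = {e \<in> E. e \<subseteq> S}"

definition is_cycle :: "nat set \<Rightarrow> nat set set \<Rightarrow> bool" where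
  "is_cycle V E \<longleftrightarrow> (\<exists>xs. distinct xs \<and> length xs \<ge> 3 \<and> set xs = V \<and>
     E = {{xs ! i, xs ! (Suc i mod length xs)} | i. i < length xs})"

definition induced_cycle_property :: "nat \<Rightarrow> multigraph set" where
  "induced_cycle_property n = {G. multigraph_on {1..n} G \<and>
     (\<exists>S. S \<subseteq> {1..n} \<and> card S = n - 1 \<and> is_cycle S (induced_edges S (simple_edges G)))}"

text \<open>The history \<open>[(u\<^sub>1, v\<^sub>1), \<dots>, (u\<^sub>t, v\<^sub>t)]\<close> of the first \<open>t\<close> rounds, in
  chronological order, determines \<open>G\<^sub>t\<close>.\<close>

type_synonym history = "(nat \<times> nat) list"

definition graph_of :: "history \<Rightarrow> multigraph" where
  "graph_of h = mset (map (\<lambda>(u, v). {u, v}) h)"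

text \<open>A strategy returns the distribution of \<open>v\<^sub>t\<close>; point masses are the deterministic
  strategies. A post-positional strategy receives the history and \<open>u\<^sub>t\<close>, a pre-positional
  one only the history.\<close>

type_synonym post_strategy = "history \<Rightarrow> nat \<Rightarrow> nat pmf"
type_synonym pre_strategy = "history \<Rightarrow> nat pmf"

definition is_post_strategy :: "nat \<Rightarrow> post_strategy \<Rightarrow> bool" where
  "is_post_strategy n f \<longleftrightarrow> (\<forall>h u. set_pmf (f h u) \<subseteq> {1..n})"

definition is_pre_strategy :: "nat \<Rightarrow> pre_strategy \<Rightarrow> bool" where
  "is_pre_strategy n f \<longleftrightarrow> (\<forall>h. set_pmf (f h) \<subseteq> {1..n})"

primrec post_process :: "nat \<Rightarrow> post_strategy \<Rightarrow> nat \<Rightarrow> history pmf" where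
  "post_process n f 0 = return_pmf []"
| "post_process n f (Suc t) =
     bind_pmf (post_process n f t) (\<lambda>h.
     bind_pmf (pmf_of_set {1..n}) (\<lambda>u.
     bind_pmf (f h u) (\<lambda>v.
     return_pmf (h @ [(u, v)]))))"

primrec pre_process :: "nat \<Rightarrow> pre_strategy \<Rightarrow> nat \<Rightarrow> history pmf" where
  "pre_process n f 0 = return_pmf []"
| "pre_process n f (Suc t) =
     bind_pmf (pre_process n f t) (\<lambda>h.
     bind_pmf (f h) (\<lambda>v.
     bind_pmf (pmf_of_set {1..n}) (\<lambda>u.
     return_pmf (h @ [(u, v)]))))"

text \<open>Having an induced cycle is not monotone under adding edges, so producing a multigraph
  in \<open>P\<close> means that \<open>G\<^sub>t \<in> P\<close> in at least one of the rounds played.\<close>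

definition produces :: "multigraph set \<Rightarrow> history \<Rightarrow> bool" where
  "produces P h \<longleftrightarrow> (\<exists>t\<le>length h. graph_of (take t h) \<in> P)"

definition aas :: "(nat \<Rightarrow> history pmf) \<Rightarrow> (nat \<Rightarrow> history \<Rightarrow> bool) \<Rightarrow> bool" where
  "aas M A \<longleftrightarrow> (\<lambda>n. measure_pmf.prob (M n) {h. A n h}) \<longlonglongrightarrow> 1"

end

theory Submission
  imports Defs "HOL-Real_Asymp.Real_Asymp"
begin

text \<open>Pre-positional process: fix the vertex \<open>w\<close> to be left out, so that \<open>S = {1..n} - {w}\<close>.
  Once a vertex of \<open>S\<close> has three neighbours in \<open>S\<close>, no induced cycle on \<open>S\<close> can appear any more.
  If \<open>r\<close> edges are still missing from the cycle and all degrees are at most \<open>2\<close>, at most \<open>2 r\<close>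
  vertices have degree less than \<open>2\<close>. So when \<open>r \<le> n/4\<close>, each round whose chosen vertex lies in
  \<open>S\<close> makes progress with probability at most \<open>1/2\<close>, has no effect with probability at most
  \<open>4/n\<close>, and destroys the cycle otherwise. Hence \<open>(3/2) ^ (n/4 - r)\<close>, set to \<open>0\<close> after the
  destruction, is a supermartingale, and by the maximal inequality the cycle on \<open>S\<close> ever appears
  with probability at most \<open>(2/3) ^ (n/4)\<close>. A union bound over \<open>w\<close> concludes, whatever the number
  of rounds.

  Post-positional process: always join \<open>u\<close> to its successor on the cycle \<open>1, 2, \<dots>, n - 1\<close>. Parallel
  edges are harmless, so it suffices that each of \<open>1, \<dots>, n - 1\<close> is drawn at least once, which
  is the coupon collector problem.\<close>

section \<open>Degrees\<close>

definition deg :: "'a set set \<Rightarrow> 'a \<Rightarrow> nat" where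
  "deg E v = card {e \<in> E. v \<in> e}"

definition graph_edges :: "'a set \<Rightarrow> 'a set set \<Rightarrow> bool" where
  "graph_edges S E \<longleftrightarrow> finite E \<and> (\<forall>e\<in>E. e \<subseteq> S \<and> card e = 2)"

lemma handshake:
  assumes "finite S" "graph_edges S E"
  shows "(\<Sum>v\<in>S. deg E v) = 2 * card E"
proof -
  have E: "finite E" "\<And>e. e \<in> E \<Longrightarrow> e \<subseteq> S" "\<And>e. e \<in> E \<Longrightarrow> card e = 2"
    using assms(2) by (auto simp: graph_edges_def)
  have "(\<Sum>v\<in>S. deg E v) = (\<Sum>e\<in>E. card {v \<in> S. v \<in> e})"
    unfolding deg_def using sum.swap_restrict[OF assms(1) E(1), of "\<lambda>_ _. 1::nat" "\<lambda>v e. v \<in> e"]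
    by simp
  also have "\<dots> = (\<Sum>e\<in>E. 2)"
  proof (rule sum.cong)
    fix e assume e: "e \<in> E"
    have "{v \<in> S. v \<in> e} = e" using E(2)[OF e] by auto
    then show "card {v \<in> S. v \<in> e} = 2" using E(3)[OF e] by simp
  qed simp
  finally show ?thesis by simp
qed

text \<open>Each vertex of degree below 2 lowers the degree sum by at least one from its maximum
  \<open>2 * card S\<close>, and by \<open>handshake\<close> that sum is
  \<open>2 * card E\<close>.\<close>

lemma card_low_degree:
  assumes "finite S" "graph_edges S E" "\<forall>v\<in>S. deg E v \<le> 2"
  shows "card {v \<in> S. deg E v < 2} + 2 * card E \<le> 2 * card S"
proof -
  have "(\<Sum>v\<in>S. deg E v) + card {v \<in> S. deg E v < 2}
      = (\<Sum>v\<in>S. deg E v + (if deg E v < 2 then 1 else 0))"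
    using assms(1) by (simp add: sum.distrib sum.If_cases Int_def)
  also have "\<dots> \<le> (\<Sum>v\<in>S. 2)"
    using assms(3) by (intro sum_mono) auto
  finally show ?thesis using handshake[OF assms(1,2)] by simp
qed

lemma deg_mono: "finite E' \<Longrightarrow> E \<subseteq> E' \<Longrightarrow> deg E v \<le> deg E' v"
  unfolding deg_def by (intro card_mono) auto

lemma deg_insert:
  assumes "finite E" "e \<notin> E" "v \<in> e"
  shows "deg (insert e E) v = Suc (deg E v)"
proof -
  have "{e' \<in> insert e E. v \<in> e'} = insert e {e' \<in> E. v \<in> e'}" using assms by auto
  then show ?thesis using assms by (simp add: deg_def)
qed

lemma card_neighbours_le_deg:
  assumes "finite E"
  shows "finite {u. {u, v} \<in> E}" "card {u. {u, v} \<in> E} \<le> deg E v"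
proof -
  have inj: "inj_on (\<lambda>u. {u, v}) {u. {u, v} \<in> E}"
    by (auto simp: inj_on_def doubleton_eq_iff)
  have sub: "(\<lambda>u. {u, v}) ` {u. {u, v} \<in> E} \<subseteq> {e \<in> E. v \<in> e}" by auto
  show "finite {u. {u, v} \<in> E}"
    using finite_subset[OF sub] assms finite_imageD[OF _ inj] by simp
  show "card {u. {u, v} \<in> E} \<le> deg E v"
    unfolding deg_def using card_inj_on_le[OF inj sub] assms by simp
qed

section \<open>Cycles\<close>

lemma is_cycle_card_deg:
  assumes "is_cycle S E"
  shows "card E = card S" "deg E v \<le> 2"
proof -
  obtain xs where xs: "distinct xs" "length xs \<ge> 3" "set xs = S"
    and E: "E = {{xs ! i, xs ! (Suc i mod length xs)} | i. i < length xs}"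
    using assms by (auto simp: is_cycle_def)
  let ?L = "length xs" and ?e = "\<lambda>i. {xs ! i, xs ! (Suc i mod length xs)}"
  have E': "E = ?e ` {..<?L}" using E by auto
  have md: "Suc i mod ?L = (if Suc i = ?L then 0 else Suc i)" if "i < ?L" for i
    using that by auto
  have lt: "Suc i mod ?L < ?L" for i using xs(2) by (intro mod_less_divisor) linarith
  have eq: "xs ! i = xs ! j \<longleftrightarrow> i = j" if "i < ?L" "j < ?L" for i j
    using xs(1) that nth_eq_iff_index_eq by blast
  have "inj_on ?e {..<?L}"
  proof (rule inj_onI)
    fix i j assume ij: "i \<in> {..<?L}" "j \<in> {..<?L}" "?e i = ?e j"
    then have "i = j \<or> (i = Suc j mod ?L \<and> Suc i mod ?L = j)"
      by (auto simp: doubleton_eq_iff eq lt)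
    \<comment> \<open>Two different indices would have to be cyclic successors of each other, which
      length at least 3 excludes.\<close>
    then show "i = j" using ij xs(2) md[of i] md[of j] by (auto split: if_splits)
  qed
  then have "card E = ?L" unfolding E' by (simp add: card_image)
  then show "card E = card S" using xs distinct_card by metis
  show "deg E v \<le> 2"
  proof (cases "v \<in> set xs")
    case True
    then obtain k where k: "k < ?L" "v = xs ! k" by (metis in_set_conv_nth)
    \<comment> \<open>\<open>p\<close> is the cyclic predecessor of \<open>k\<close>: the only edges
      at \<open>xs ! k\<close> are those with index \<open>k\<close> and \<open>p\<close>.\<close>
    define p where "p = (if k = 0 then ?L - 1 else k - 1)"
    have "{e \<in> E. v \<in> e} \<subseteq> {?e k, ?e p}"
    proof
      fix e assume "e \<in> {e \<in> E. v \<in> e}"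
      then obtain i where i: "i < ?L" "e = ?e i" "v \<in> ?e i" using E by auto
      have "k = i \<or> k = Suc i mod ?L" using i k by (auto simp: eq lt)
      then have "i = k \<or> i = p" using i(1) md[OF i(1)] by (auto simp: p_def split: if_splits)
      then show "e \<in> {?e k, ?e p}" using i by auto
    qed
    then have "card {e \<in> E. v \<in> e} \<le> card {?e k, ?e p}" by (intro card_mono) auto
    also have "\<dots> \<le> 2" by (simp add: card_insert_if)
    finally show ?thesis by (simp add: deg_def)
  next
    case False
    then have "{e \<in> E. v \<in> e} = {}" using lt unfolding E by auto
    then show ?thesis by (simp add: deg_def del: Collect_empty_eq)
  qed
qed

section \<open>The pre-positional process\<close>

text \<open>\<open>card S - card E\<close> counts the edges still missing from a cycle on
  \<open>S\<close>. By truncated subtraction the exponent is 0 as long as at least \<open>k\<close>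
  are missing. The value 0 marks a ruined configuration, which has a vertex of degree at least
  3.\<close>

definition potential :: "nat \<Rightarrow> 'a set \<Rightarrow> 'a set set \<Rightarrow> real" where
  "potential k S E =
     (if \<forall>v\<in>S. deg E v \<le> 2 then (3/2) ^ (k - (card S - card E)) else 0)"

lemma potential_nonneg: "potential k S E \<ge> 0"
  by (simp add: potential_def)

text \<open>One edge raises the exponent by at most 1. If more than \<open>k\<close> edges are
  missing, the exponent is 0 before and after the insertion.\<close>

lemma potential_insert_le:
  assumes "finite S" "graph_edges S E" "\<forall>v\<in>S. deg E v \<le> 2" "e \<notin> E"
  shows "potential k S (insert e E) \<le> 3/2 * potential k S E"
    and "k < card S - card E \<Longrightarrow> potential k S (insert e E) \<le> potential k S E"
proof -
  have E: "finite E" using assms(2) by (simp add: graph_edges_def)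
  have c: "card (insert e E) = Suc (card E)" using E assms(4) by simp
  have "k - (card S - Suc (card E)) \<le> Suc (k - (card S - card E))" by linarith
  then have "(3/2::real) ^ (k - (card S - Suc (card E))) \<le> (3/2) ^ Suc (k - (card S - card E))"
    by (intro power_increasing) auto
  then show "potential k S (insert e E) \<le> 3/2 * potential k S E"
    using assms(3) unfolding potential_def c by auto
  show "potential k S (insert e E) \<le> potential k S E" if "k < card S - card E"
    using that assms(3) unfolding potential_def c by auto
qed

lemma potential_insert_full:
  assumes "finite E" "e \<notin> E" "v \<in> S" "v \<in> e" "deg E v \<ge> 2"
  shows "potential k S (insert e E) = 0"
proof -
  have "deg (insert e E) v > 2" using deg_insert[OF assms(1,2,4)] assms(5) by simp
  then show ?thesis using assms(3) unfolding potential_def by force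
qed

text \<open>\<open>4 + 3/2 * 2 * (n/4) \<le> n\<close> for \<open>n \<ge> 16\<close>: four vertices \<open>u\<close> (namely \<open>w\<close>, \<open>v\<close> and the
  neighbours of \<open>v\<close>) leave \<open>E\<close> unchanged, and at most \<open>2 * (n/4)\<close> keep the degrees below \<open>3\<close>.\<close>

lemma potential_step:
  fixes V :: "'a set"
  assumes V: "finite V" "card V = n" "w \<in> V" "n \<ge> 16" and E: "graph_edges (V - {w}) E"
  shows "(\<Sum>u\<in>V. potential (n div 4) (V - {w})
            (if {u, v} \<subseteq> V - {w} \<and> u \<noteq> v then insert {u, v} E else E))
          \<le> real n * potential (n div 4) (V - {w}) E"
proof -
  define S where "S = V - {w}"
  define k where "k = n div 4"
  define new where "new u = (if {u, v} \<subseteq> S \<and> u \<noteq> v then insert {u, v} E else E)" for u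
  define P where "P = potential k S E"
  have S: "finite S" "card S = n - 1" using V by (auto simp: S_def)
  have E: "graph_edges S E" "finite E" using E by (auto simp: S_def graph_edges_def)
  have P0: "P \<ge> 0" by (simp add: P_def potential_nonneg)
  have "(\<Sum>u\<in>V. potential k S (new u)) \<le> real n * P"
  proof (cases "\<forall>x\<in>S. deg E x \<le> 2")
    \<comment> \<open>Degrees never decrease, so a ruined configuration stays ruined.\<close>
    case False
    then obtain x where x: "x \<in> S" "deg E x > 2" by force
    have "potential k S (new u) = 0" for u
    proof -
      have "deg E x \<le> deg (new u) x" using E(2) by (intro deg_mono) (auto simp: new_def)
      then show ?thesis using x unfolding potential_def by force
    qed
    then show ?thesis using P0 by simp
  next
    case alive: True
    have stay: "potential k S (new u) = P" if "{u, v} \<in> E \<or> \<not> ({u, v} \<subseteq> S \<and> u \<noteq> v)" for u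
      using that by (auto simp: new_def P_def insert_absorb)
    have grow: "new u = insert {u, v} E" if "{u, v} \<subseteq> S" "u \<noteq> v" for u
      using that by (auto simp: new_def)
    show ?thesis
    proof (cases "v \<in> S \<and> \<not> k < card S - card E")
      \<comment> \<open>No \<open>u\<close> can raise the potential here: either \<open>v\<close> is
        outside \<open>S\<close> and nothing is inserted, or too many edges are missing for the
        exponent to grow.\<close>
      case False
      have "potential k S (new u) \<le> P" for u
      proof (cases "{u, v} \<in> E \<or> \<not> ({u, v} \<subseteq> S \<and> u \<noteq> v)")
        case True
        then show ?thesis using stay by simp
      next
        case f: False
        then have "k < card S - card E" using False by auto
        then show ?thesis using f grow[of u] potential_insert_le(2)[OF S(1) E(1) alive, of "{u, v}" k]
          by (simp add: P_def)
      qed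
      then have "(\<Sum>u\<in>V. potential k S (new u)) \<le> (\<Sum>u\<in>V. P)" by (intro sum_mono) auto
      then show ?thesis using V by simp
    next
      case True
      define B where "B = insert w (insert v {u. {u, v} \<in> E})"
      define D where "D = {x \<in> S. deg E x < 2}"
      have nb: "finite {u. {u, v} \<in> E}" "card {u. {u, v} \<in> E} \<le> 2"
        using card_neighbours_le_deg[OF E(2), of v] alive True by (auto intro: order_trans)
      have B: "finite B" "card B \<le> 4"
      proof -
        show "finite B" using nb by (simp add: B_def)
        have "card B \<le> Suc (Suc (card {u. {u, v} \<in> E}))"
          using nb(1) by (simp add: B_def card_insert_if)
        then show "card B \<le> 4" using nb by linarith
      qed
      have D: "finite D" using S by (simp add: D_def)
      have "card D + 2 * card E \<le> 2 * card S"
        using card_low_degree[OF S(1) E(1) alive] by (simp add: D_def)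
      then have "card D \<le> 2 * (card S - card E)" by linarith
      also have "\<dots> \<le> 2 * k" using True by linarith
      finally have cD: "2 * card D \<le> n" unfolding k_def by linarith
      \<comment> \<open>For \<open>u\<close> outside \<open>B\<close> the edge is new and lies
        inside \<open>S\<close>. It gains a factor of at most 3/2 if \<open>u\<close> has degree
        below 2, and otherwise gives \<open>u\<close> degree 3.\<close>
      have bnd: "potential k S (new u) \<le> indicator B u * P + indicator D u * (3/2 * P)"
        if "u \<in> V" for u
      proof (cases "u \<in> B")
        case u: True
        then have "potential k S (new u) = P" using stay[of u] by (auto simp: B_def S_def)
        then show ?thesis using u P0 by (auto simp: indicator_def)
      next
        case u: False
        then have uv: "{u, v} \<subseteq> S" "u \<noteq> v" "{u, v} \<notin> E" "u \<in> S"
          using that True by (auto simp: B_def S_def)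
        show ?thesis
        proof (cases "u \<in> D")
          case True
          then show ?thesis using u grow[OF uv(1,2)]
            potential_insert_le(1)[OF S(1) E(1) alive uv(3), of k] by (simp add: P_def)
        next
          case False
          then have "potential k S (new u) = 0"
            using potential_insert_full[OF E(2) uv(3), of u S k] grow[OF uv(1,2)] uv(4)
            by (auto simp: D_def)
          then show ?thesis using u False by simp
        qed
      qed
      have "(\<Sum>u\<in>V. potential k S (new u))
          \<le> (\<Sum>u\<in>V. indicator B u * P + indicator D u * (3/2 * P))"
        using bnd by (intro sum_mono)
      also have "\<dots> = real (card (V \<inter> B)) * P + real (card (V \<inter> D)) * (3/2 * P)"
        using V(1) by (simp only: sum.distrib sum_indicator_mult sum_constant Int_def)
      also have "\<dots> = (real (card (V \<inter> B)) + 3/2 * real (card (V \<inter> D))) * P"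
        by (simp add: algebra_simps)
      also have "\<dots> \<le> real n * P"
      proof (intro mult_right_mono P0)
        have "card (V \<inter> B) \<le> card B" "card (V \<inter> D) \<le> card D"
          using B D by (auto intro: card_mono)
        then show "real (card (V \<inter> B)) + 3/2 * real (card (V \<inter> D)) \<le> real n"
          using B(2) cD V(4) by linarith
      qed
      finally show ?thesis .
    qed
  qed
  then show ?thesis unfolding P_def new_def S_def k_def by simp
qed

section \<open>Supermartingales along the pre-positional process\<close>

text \<open>This is where being pre-positional matters: \<open>u\<close> is drawn independently of
  \<open>v\<close>, so a bound on the average over \<open>u\<close> for every fixed \<open>v\<close>
  survives averaging over the choice of \<open>v\<close> by any strategy.\<close>

lemma pre_process_supermartingale:
  fixes \<Phi> :: "history \<Rightarrow> ennreal"
  assumes "\<And>h v. (\<integral>\<^sup>+u. \<Phi> (h @ [(u, v)]) \<partial>pmf_of_set {1..n}) \<le> \<Phi> h"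
  shows "(\<integral>\<^sup>+h. \<Phi> h \<partial>pre_process n f t) \<le> \<Phi> []"
proof (induction t)
  case (Suc t)
  have "(\<integral>\<^sup>+h. \<Phi> h \<partial>pre_process n f (Suc t)) =
    (\<integral>\<^sup>+h. \<integral>\<^sup>+v. \<integral>\<^sup>+u. \<Phi> (h @ [(u, v)]) \<partial>pmf_of_set {1..n} \<partial>f h \<partial>pre_process n f t)"
    by simp
  also have "\<dots> \<le> (\<integral>\<^sup>+h. \<integral>\<^sup>+v. \<Phi> h \<partial>f h \<partial>pre_process n f t)"
    by (intro nn_integral_mono assms)
  also have "\<dots> = (\<integral>\<^sup>+h. \<Phi> h \<partial>pre_process n f t)"
    by (simp add: measure_pmf.emeasure_space_1)
  finally show ?case using Suc by (rule order_trans)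
qed simp

text \<open>The process is stopped by replacing \<open>\<Phi>\<close> with the constant \<open>A\<close> from the first time on at
  which it reaches \<open>A\<close>.\<close>

lemma pre_process_maximal_inequality:
  fixes \<Phi> :: "history \<Rightarrow> ennreal"
  assumes step: "\<And>h v. (\<integral>\<^sup>+u. \<Phi> (h @ [(u, v)]) \<partial>pmf_of_set {1..n}) \<le> \<Phi> h"
  shows "A * emeasure (pre_process n f t) {h. \<exists>s\<le>length h. A \<le> \<Phi> (take s h)} \<le> \<Phi> []"
proof -
  define hit where "hit h \<longleftrightarrow> (\<exists>s\<le>length h. A \<le> \<Phi> (take s h))" for h
  define \<Psi> where "\<Psi> h = (if hit h then A else \<Phi> h)" for h
  have hit_append: "hit (h @ [x]) \<longleftrightarrow> hit h \<or> A \<le> \<Phi> (h @ [x])" for h x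
    by (auto simp: hit_def le_Suc_eq)
  have "(\<integral>\<^sup>+u. \<Psi> (h @ [(u, v)]) \<partial>pmf_of_set {1..n}) \<le> \<Psi> h" for h v
  proof (cases "hit h")
    case True
    then show ?thesis by (simp add: \<Psi>_def hit_append measure_pmf.emeasure_space_1)
  next
    case False
    have "(\<integral>\<^sup>+u. \<Psi> (h @ [(u, v)]) \<partial>pmf_of_set {1..n})
        \<le> (\<integral>\<^sup>+u. \<Phi> (h @ [(u, v)]) \<partial>pmf_of_set {1..n})"
      \<comment> \<open>If the next history is the first to hit, then \<open>\<Psi>\<close> is
        \<open>A\<close> there, which is at most \<open>\<Phi>\<close>.\<close>
      using False by (intro nn_integral_mono) (auto simp: \<Psi>_def hit_append)
    then show ?thesis using step[of h v] False by (auto simp: \<Psi>_def)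
  qed
  then have "(\<integral>\<^sup>+h. \<Psi> h \<partial>pre_process n f t) \<le> \<Psi> []"
    by (rule pre_process_supermartingale)
  also have "\<Psi> [] \<le> \<Phi> []" by (auto simp: \<Psi>_def hit_def)
  finally have "(\<integral>\<^sup>+h. \<Psi> h \<partial>pre_process n f t) \<le> \<Phi> []" .
  moreover have "A * emeasure (pre_process n f t) {h. hit h} =
      (\<integral>\<^sup>+h. A * indicator {h. hit h} h \<partial>pre_process n f t)"
    by (simp add: nn_integral_cmult)
  \<comment> \<open>This is the argument of Markov's inequality: \<open>\<Psi>\<close> equals
    \<open>A\<close> on the event of a hit.\<close>
  moreover have "\<dots> \<le> (\<integral>\<^sup>+h. \<Psi> h \<partial>pre_process n f t)"
    by (intro nn_integral_mono) (auto simp: \<Psi>_def indicator_def)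
  ultimately have "A * emeasure (pre_process n f t) {h. hit h} \<le> \<Phi> []"
    by simp
  then show ?thesis by (simp add: hit_def)
qed

section \<open>Probability that an induced cycle ever appears\<close>

abbreviation edges_in :: "nat set \<Rightarrow> history \<Rightarrow> nat set set" where
  "edges_in S h \<equiv> induced_edges S (simple_edges (graph_of h))"

lemma edges_in_append:
  "edges_in S (h @ [(u, v)]) =
     (if {u, v} \<subseteq> S \<and> u \<noteq> v then insert {u, v} (edges_in S h) else edges_in S h)"
  by (auto simp: induced_edges_def simple_edges_def graph_of_def card_insert_if)

lemma graph_edges_edges_in: "graph_edges S (edges_in S h)"
  by (auto simp: graph_edges_def induced_edges_def simple_edges_def)

lemma prob_induced_cycle_le:
  assumes n: "n \<ge> 16" and w: "w \<in> {1..n}"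
  shows "measure_pmf.prob (pre_process n f t)
           {h. \<exists>s\<le>length h. is_cycle ({1..n} - {w}) (edges_in ({1..n} - {w}) (take s h))}
         \<le> (2/3) ^ (n div 4)"
proof -
  define S where "S = {1..n} - {w}"
  define A :: real where "A = (3/2) ^ (n div 4)"
  define \<phi> where "\<phi> h = potential (n div 4) S (edges_in S h)" for h
  define X where "X = {h. \<exists>s\<le>length h. ennreal A \<le> ennreal (\<phi> (take s h))}"
  have A: "A > 0" by (simp add: A_def)
  have \<phi>_nonneg: "\<phi> h \<ge> 0" for h by (simp add: \<phi>_def potential_nonneg)
  have S: "finite S" "card S = n - 1" using w by (auto simp: S_def)
  have "(\<integral>\<^sup>+u. ennreal (\<phi> (h @ [(u, v)])) \<partial>pmf_of_set {1..n}) \<le> ennreal (\<phi> h)" for h v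
  proof -
    have "(\<Sum>u\<in>{1..n}. \<phi> (h @ [(u, v)])) \<le> real n * \<phi> h"
      unfolding \<phi>_def edges_in_append S_def
      using graph_edges_edges_in n w by (intro potential_step) auto
    then have "(\<Sum>u\<in>{1..n}. \<phi> (h @ [(u, v)])) / real n \<le> \<phi> h"
      using n by (simp add: field_simps)
    moreover have "(\<integral>\<^sup>+u. ennreal (\<phi> (h @ [(u, v)])) \<partial>pmf_of_set {1..n})
        = (\<Sum>u\<in>{1..n}. ennreal (\<phi> (h @ [(u, v)]))) / ennreal (real n)"
      using n by (subst nn_integral_pmf_of_set) (auto simp: ennreal_of_nat_eq_real_of_nat)
    moreover have "\<dots> = ennreal ((\<Sum>u\<in>{1..n}. \<phi> (h @ [(u, v)])) / real n)"
      using n \<phi>_nonneg by (simp add: sum_nonneg divide_ennreal del: One_nat_def)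
    ultimately show ?thesis by (simp add: ennreal_leI)
  qed
  then have "ennreal A * emeasure (pre_process n f t) X \<le> ennreal (\<phi> [])"
    unfolding X_def by (rule pre_process_maximal_inequality)
  \<comment> \<open>Initially \<open>n - 1\<close> edges are missing, more than
    \<open>n div 4\<close>, so the exponent is 0.\<close>
  also have "\<phi> [] = 1"
    using n S by (simp add: \<phi>_def potential_def deg_def graph_of_def simple_edges_def induced_edges_def)
  finally have "A * measure_pmf.prob (pre_process n f t) X \<le> 1"
    using A by (simp add: measure_pmf.emeasure_eq_measure flip: ennreal_mult)
  then have "measure_pmf.prob (pre_process n f t) X \<le> 1 / A"
    using A by (simp add: field_simps)
  also have "1 / A = (2/3) ^ (n div 4)" by (simp add: A_def power_divide)
  finally have *: "measure_pmf.prob (pre_process n f t) X \<le> (2/3) ^ (n div 4)" .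
  \<comment> \<open>A cycle on \<open>S\<close> has no missing edge and no degree above 2, so the
    exponent takes its full value \<open>n div 4\<close>.\<close>
  have "\<phi> h = A" if "is_cycle S (edges_in S h)" for h
    using is_cycle_card_deg[OF that] by (simp add: \<phi>_def potential_def A_def)
  then have "{h. \<exists>s\<le>length h. is_cycle S (edges_in S (take s h))} \<subseteq> X"
    unfolding X_def by fastforce
  then have "measure_pmf.prob (pre_process n f t)
      {h. \<exists>s\<le>length h. is_cycle S (edges_in S (take s h))} \<le> measure_pmf.prob (pre_process n f t) X"
    by (intro measure_pmf.finite_measure_mono) auto
  then show ?thesis using * unfolding S_def by (rule order_trans)
qed

lemma prob_pre_produces_le:
  assumes n: "n \<ge> 16"
  shows "measure_pmf.prob (pre_process n f t) {h. produces (induced_cycle_property n) h}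
         \<le> real n * (2/3) ^ (n div 4)"
proof -
  define X where "X w = {h. \<exists>s\<le>length h.
    is_cycle ({1..n} - {w}) (edges_in ({1..n} - {w}) (take s h))}" for w
  have "{h. produces (induced_cycle_property n) h} \<subseteq> (\<Union>w\<in>{1..n}. X w)"
  proof
    fix h assume "h \<in> {h. produces (induced_cycle_property n) h}"
    then obtain s S where s: "s \<le> length h" and S: "S \<subseteq> {1..n}" "card S = n - 1"
      and c: "is_cycle S (edges_in S (take s h))"
      by (auto simp: produces_def induced_cycle_property_def)
    have "card ({1..n} - S) = 1" using S n by (simp add: card_Diff_subset finite_subset)
    then obtain w where "{1..n} - S = {w}" by (auto simp: card_1_singleton_iff)
    then have "w \<in> {1..n}" "S = {1..n} - {w}" using S by blast+
    then show "h \<in> (\<Union>w\<in>{1..n}. X w)" using s c by (auto simp: X_def)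
  qed
  then have "measure_pmf.prob (pre_process n f t) {h. produces (induced_cycle_property n) h}
      \<le> measure_pmf.prob (pre_process n f t) (\<Union>w\<in>{1..n}. X w)"
    by (intro measure_pmf.finite_measure_mono) auto
  also have "\<dots> \<le> (\<Sum>w\<in>{1..n}. measure_pmf.prob (pre_process n f t) (X w))"
    by (intro measure_pmf.finite_measure_subadditive_finite) auto
  also have "\<dots> \<le> (\<Sum>w\<in>{1..n}. (2/3) ^ (n div 4))"
    unfolding X_def using prob_induced_cycle_le[OF n] by (intro sum_mono) auto
  finally show ?thesis by simp
qed

lemma aas_if_prob_compl_le:
  assumes le: "\<forall>\<^sub>F n in sequentially. measure_pmf.prob (M n) {h. \<not> A n h} \<le> b n"
    and lim: "b \<longlonglongrightarrow> 0"
  shows "aas M A"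
proof -
  have eq: "measure_pmf.prob (M n) {h. A n h} = 1 - measure_pmf.prob (M n) {h. \<not> A n h}" for n
    using measure_pmf.prob_compl[of "{h. \<not> A n h}" "M n"]
    by (simp add: Compl_eq_Diff_UNIV[symmetric] Collect_neg_eq)
  have "(\<lambda>n. measure_pmf.prob (M n) {h. \<not> A n h}) \<longlonglongrightarrow> 0"
    by (rule tendsto_sandwich[OF _ le tendsto_const lim]) simp
  then have "(\<lambda>n. 1 - measure_pmf.prob (M n) {h. \<not> A n h}) \<longlonglongrightarrow> 1 - 0"
    by (intro tendsto_intros)
  then show ?thesis by (simp add: aas_def eq)
qed

section \<open>The post-positional process\<close>

text \<open>The modulus sends \<open>n - 1\<close> back to 1. Drawing \<open>n\<close> produces a
  loop at the left-out vertex and so no edge inside \<open>{1..n - 1}\<close>.\<close>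

definition cycle_succ :: "nat \<Rightarrow> nat \<Rightarrow> nat" where
  "cycle_succ n u = (if u < n then u mod (n - 1) + 1 else n)"

definition cycle_strategy :: "nat \<Rightarrow> post_strategy" where
  "cycle_strategy n h u = return_pmf (cycle_succ n u)"

lemma cycle_succ_range:
  assumes "n \<ge> 1"
  shows "cycle_succ n u \<in> {1..n}"
\<comment> \<open>For \<open>n = 1\<close> the modulus is 0 and \<open>u mod 0 = u\<close>; only
  \<open>u = 0\<close> is below \<open>n\<close>, and it is sent to 1.\<close>
proof (cases "n = 1")
  case False
  then have "u mod (n - 1) < n - 1" using assms by (intro mod_less_divisor) auto
  then show ?thesis using assms by (auto simp: cycle_succ_def)
qed (auto simp: cycle_succ_def)

lemma post_process_support:
  assumes "n \<ge> 1" "h \<in> set_pmf (post_process n (cycle_strategy n) t)" "(u, v) \<in> set h"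
  shows "u \<in> {1..n} \<and> v = cycle_succ n u"
  using assms(2,3)
proof (induction t arbitrary: h)
  case (Suc t)
  then show ?case using assms(1)
    by (auto simp: cycle_strategy_def)
qed simp

text \<open>The draws are independent of the history, whatever the strategy, so the indicator
  factorises over the rounds and each round contributes \<open>1 - 1 / real n\<close>.\<close>

lemma prob_not_drawn:
  assumes "i \<in> {1..n}"
  shows "measure_pmf.prob (post_process n f t) {h. i \<notin> fst ` set h} = (1 - 1 / real n) ^ t"
proof -
  define I where "I h = (indicator {h. i \<notin> fst ` set h} h :: ennreal)" for h :: history
  define J where "J u = (indicator (-{i}) u :: ennreal)" for u :: nat
  have n: "n \<ge> 1" using assms by auto
  have "measure_pmf.prob (pmf_of_set {1..n}) (-{i}) = real (card ({1..n} - {i})) / real n"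
    using n by (simp add: measure_pmf_of_set Diff_eq)
  also have "\<dots> = 1 - 1 / real n"
    using n assms by (simp add: field_simps)
  finally have q: "(\<integral>\<^sup>+u. J u \<partial>pmf_of_set {1..n}) = ennreal (1 - 1 / real n)"
    by (simp add: J_def measure_pmf.emeasure_eq_measure)
  have IJ: "I (h @ [(u, v)]) = I h * J u" for h u v
    by (auto simp: I_def J_def indicator_def)
  have "(\<integral>\<^sup>+h. I h \<partial>post_process n f t) = ennreal ((1 - 1 / real n) ^ t)"
  proof (induction t)
    case 0
    then show ?case by (simp add: I_def)
  next
    case (Suc t)
    have "(\<integral>\<^sup>+h. I h \<partial>post_process n f (Suc t)) =
        (\<integral>\<^sup>+h. I h * ennreal (1 - 1 / real n) \<partial>post_process n f t)"
      by (simp add: IJ nn_integral_cmult measure_pmf.emeasure_space_1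
          q[symmetric])
    also have "\<dots> = ennreal ((1 - 1 / real n) ^ t) * ennreal (1 - 1 / real n)"
      by (simp add: nn_integral_multc Suc)
    also have "\<dots> = ennreal ((1 - 1 / real n) ^ Suc t)"
      using n by (simp add: mult.commute flip: ennreal_mult)
    finally show ?case .
  qed
  then show ?thesis
    using n by (simp add: I_def measure_pmf.emeasure_eq_measure)
qed

text \<open>Every edge inside \<open>{1..n - 1}\<close> joins a vertex to its successor, and each
  such edge occurs once its vertex is drawn. The bound \<open>n \<ge> 4\<close> makes the cycle
  length at least 3.\<close>

lemma cycle_strategy_produces:
  assumes n: "n \<ge> 4"
    and pairs: "\<And>u v. (u, v) \<in> set h \<Longrightarrow> u \<in> {1..n} \<and> v = cycle_succ n u"
    and all: "{1..n - 1} \<subseteq> fst ` set h"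
  shows "produces (induced_cycle_property n) h"
proof -
  let ?c = "cycle_succ n" and ?xs = "[1..<n]"
  have c: "?c u \<in> {1..n}" for u using n by (intro cycle_succ_range) simp
  have md: "u mod (n - 1) = (if u = n - 1 then 0 else u)" if "u \<le> n - 1" for u
    using that n by (cases "u = n - 1") auto
  have ne: "?c u \<noteq> u" "?c u \<in> {1..n - 1}" if "u \<in> {1..n - 1}" for u
    using md[of u] that n by (auto simp: cycle_succ_def)
  have mem: "{u, ?c u} \<in># graph_of h" if "u \<in> {1..n - 1}" for u
  proof -
    have "u \<in> fst ` set h" using all that by blast
    then obtain v where v: "(u, v) \<in> set h" by auto
    then show ?thesis using pairs[OF v] by (force simp: graph_of_def)
  qed
  have "edges_in {1..n - 1} h = (\<lambda>u. {u, ?c u}) ` {1..n - 1}"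
  proof (intro equalityI subsetI)
    fix e assume "e \<in> edges_in {1..n - 1} h"
    then obtain u v where "(u, v) \<in> set h" "e = {u, v}" "e \<subseteq> {1..n - 1}"
      by (auto simp: induced_edges_def simple_edges_def graph_of_def)
    then show "e \<in> (\<lambda>u. {u, ?c u}) ` {1..n - 1}" using pairs by blast
  next
    fix e assume "e \<in> (\<lambda>u. {u, ?c u}) ` {1..n - 1}"
    then obtain u where u: "u \<in> {1..n - 1}" "e = {u, ?c u}" by blast
    then show "e \<in> edges_in {1..n - 1} h"
      using mem[OF u(1)] ne[OF u(1)] by (simp add: induced_edges_def simple_edges_def)
  qed
  \<comment> \<open>Vertex \<open>u\<close> sits at position \<open>u - 1\<close> of
    \<open>[1..<n]\<close>, hence the shift by \<open>Suc\<close>.\<close>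
  also have "(\<lambda>u. {u, ?c u}) ` {1..n - 1} = (\<lambda>u. {u, ?c u}) ` Suc ` {..<n - 1}"
    by (simp add: lessThan_atLeast0 atLeastLessThanSuc_atLeastAtMost)
  also have "\<dots> = (\<lambda>i. {?xs ! i, ?xs ! (Suc i mod length ?xs)}) ` {..<n - 1}"
  proof -
    have "{Suc i, ?c (Suc i)} = {?xs ! i, ?xs ! (Suc i mod length ?xs)}" if "i < n - 1" for i
    proof -
      have "Suc i mod (n - 1) < n - 1" using n by (intro mod_less_divisor) simp
      then have "?xs ! (Suc i mod (n - 1)) = Suc (Suc i mod (n - 1))"
        by (subst nth_upt) auto
      moreover have "Suc i < n" using that by simp
      ultimately show ?thesis by (simp add: cycle_succ_def)
    qed
    then show ?thesis unfolding image_image by (intro image_cong) auto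
  qed
  also have "\<dots> = {{?xs ! i, ?xs ! (Suc i mod length ?xs)} | i. i < length ?xs}"
    by (simp add: setcompr_eq_image lessThan_def)
  finally have edges: "edges_in {1..n - 1} h =
      {{?xs ! i, ?xs ! (Suc i mod length ?xs)} | i. i < length ?xs}" .
  have "set ?xs = {1..n - 1}" "length ?xs \<ge> 3" using n by auto
  then have "is_cycle {1..n - 1} (edges_in {1..n - 1} h)"
    unfolding is_cycle_def using edges distinct_upt by blast
  moreover have "multigraph_on {1..n} (graph_of h)"
    using pairs c by (fastforce simp: multigraph_on_def graph_of_def)
  ultimately have "graph_of h \<in> induced_cycle_property n"
    unfolding induced_cycle_property_def using n
    by (auto intro!: exI[of _ "{1..n - 1}"])
  then show ?thesis unfolding produces_def by (intro exI[of _ "length h"]) simp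
qed

text \<open>After \<open>2 * real n * ln (real n)\<close> rounds a given vertex is undrawn with
  probability at most \<open>1 / n^2\<close>; the constant 2 lets this beat the \<open>n\<close>
  terms of the union bound.\<close>

lemma prob_post_not_produces_le:
  assumes n: "n \<ge> 4" and t: "real t \<ge> 2 * real n * ln (real n)"
  shows "measure_pmf.prob (post_process n (cycle_strategy n) t)
           {h. \<not> produces (induced_cycle_property n) h} \<le> 1 / real n"
proof -
  let ?M = "post_process n (cycle_strategy n) t"
  have "measure_pmf.prob ?M {h. \<not> produces (induced_cycle_property n) h}
      \<le> measure_pmf.prob ?M (\<Union>i\<in>{1..n}. {h. i \<notin> fst ` set h})"
  \<comment> \<open>The inclusion of events is only claimed on the support, where every pair has the
    form \<open>(u, cycle_succ n u)\<close>.\<close>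
  proof (intro measure_pmf.finite_measure_mono_AE)
    show "AE h in ?M. h \<in> {h. \<not> produces (induced_cycle_property n) h} \<longrightarrow>
        h \<in> (\<Union>i\<in>{1..n}. {h. i \<notin> fst ` set h})"
    proof (intro AE_pmfI impI)
      fix h assume h: "h \<in> set_pmf ?M" "h \<in> {h. \<not> produces (induced_cycle_property n) h}"
      have "\<not> {1..n - 1} \<subseteq> fst ` set h"
        using cycle_strategy_produces[OF n post_process_support[OF _ h(1)]] h(2) n by auto
      then obtain i where "i \<in> {1..n - 1}" "i \<notin> fst ` set h" by blast
      then show "h \<in> (\<Union>i\<in>{1..n}. {h. i \<notin> fst ` set h})"
        by (intro UN_I[of i]) auto
    qed
  qed auto
  also have "\<dots> \<le> (\<Sum>i\<in>{1..n}. measure_pmf.prob ?M {h. i \<notin> fst ` set h})"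
    by (intro measure_pmf.finite_measure_subadditive_finite) auto
  also have "\<dots> = real n * (1 - 1 / real n) ^ t"
    using prob_not_drawn[of _ n "cycle_strategy n" t] by simp
  also have "\<dots> \<le> real n * exp (- 2 * ln (real n))"
  proof (intro mult_left_mono)
    have "(1 - 1 / real n) ^ t \<le> exp (- (1 / real n)) ^ t"
      using exp_ge_add_one_self[of "- (1 / real n)"] n by (intro power_mono) auto
    also have "\<dots> = exp (- (real t / real n))"
      by (simp flip: exp_of_nat_mult)
    also have "\<dots> \<le> exp (- 2 * ln (real n))"
      using t n by (simp add: field_simps)
    finally show "(1 - 1 / real n) ^ t \<le> exp (- 2 * ln (real n))" .
  qed simp
  also have "\<dots> = 1 / real n"
  proof -
    have "exp (- 2 * ln (real n)) = 1 / (exp (ln (real n)) * exp (ln (real n)))"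
      by (simp add: exp_minus field_simps flip: exp_add)
    then show ?thesis using n by simp
  qed
  finally show ?thesis .
qed

section \<open>Limits of the two error bounds\<close>

theorem theorem1p7:
  shows "(\<forall>(f :: nat \<Rightarrow> pre_strategy) (T :: nat \<Rightarrow> nat).
            (\<forall>n\<ge>1. is_pre_strategy n (f n)) \<longrightarrow>
            aas (\<lambda>n. pre_process n (f n) (T n))
                (\<lambda>n h. \<not> produces (induced_cycle_property n) h))
       \<and> (\<exists>(f :: nat \<Rightarrow> post_strategy) (T :: nat \<Rightarrow> nat).
            (\<forall>n\<ge>1. is_post_strategy n (f n)) \<and>
            (\<lambda>n. real (T n)) \<in> O(\<lambda>n. real n * ln (real n)) \<and>
            aas (\<lambda>n. post_process n (f n) (T n))
                (\<lambda>n h. produces (induced_cycle_property n) h))"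
proof (intro conjI allI impI)
  fix f :: "nat \<Rightarrow> pre_strategy" and T :: "nat \<Rightarrow> nat"
  have "\<forall>\<^sub>F n in sequentially. measure_pmf.prob (pre_process n (f n) (T n))
      {h. \<not> \<not> produces (induced_cycle_property n) h} \<le> real n * (2/3) ^ (n div 4)"
    using eventually_ge_at_top[of 16] by eventually_elim (simp add: prob_pre_produces_le)
  moreover have "(\<lambda>n. real n * (2/3) ^ (n div 4)) \<longlonglongrightarrow> 0"
  proof (rule tendsto_sandwich[OF _ _ tendsto_const])
    show "\<forall>\<^sub>F n in sequentially. real n * (2/3) ^ (n div 4)
        \<le> real n * (2/3) powr (real n / 4 - 1)"
    proof (intro always_eventually allI mult_left_mono)
      fix n :: nat
      \<comment> \<open>Bounding the integer quotient from below by a real exponent gives an upper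
        bound, since the base is below 1, and leaves an expression with an elementary limit.\<close>
      have "real n / 4 - 1 \<le> real (n div 4)" by linarith
      then have "(2/3 :: real) powr real (n div 4) \<le> (2/3) powr (real n / 4 - 1)"
        by (intro powr_mono') auto
      then show "(2/3 :: real) ^ (n div 4) \<le> (2/3) powr (real n / 4 - 1)"
        by (simp add: powr_realpow)
    qed simp
    show "(\<lambda>n. real n * (2/3) powr (real n / 4 - 1)) \<longlonglongrightarrow> 0"
      by real_asymp
  qed simp
  ultimately show "aas (\<lambda>n. pre_process n (f n) (T n))
      (\<lambda>n h. \<not> produces (induced_cycle_property n) h)"
    by (rule aas_if_prob_compl_le)
next
  define T where "T n = nat \<lceil>2 * real n * ln (real n)\<rceil>" for n
  have T: "real (T n) \<ge> 2 * real n * ln (real n)" for n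
    unfolding T_def by linarith
  have "\<forall>n\<ge>1. is_post_strategy n (cycle_strategy n)"
    using cycle_succ_range by (auto simp: is_post_strategy_def cycle_strategy_def)
  moreover have "(\<lambda>n. real (T n)) \<in> O(\<lambda>n. real n * ln (real n))"
    unfolding T_def by real_asymp
  moreover have "aas (\<lambda>n. post_process n (cycle_strategy n) (T n))
      (\<lambda>n h. produces (induced_cycle_property n) h)"
  proof (rule aas_if_prob_compl_le)
    show "\<forall>\<^sub>F n in sequentially. measure_pmf.prob (post_process n (cycle_strategy n) (T n))
        {h. \<not> produces (induced_cycle_property n) h} \<le> 1 / real n"
      using eventually_ge_at_top[of 4]
      by eventually_elim (simp add: prob_post_not_produces_le T)
    show "(\<lambda>n. 1 / real n) \<longlonglongrightarrow> 0" by real_asymp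
  qed
  ultimately show "\<exists>(f :: nat \<Rightarrow> post_strategy) (T :: nat \<Rightarrow> nat).
      (\<forall>n\<ge>1. is_post_strategy n (f n)) \<and>
      (\<lambda>n. real (T n)) \<in> O(\<lambda>n. real n * ln (real n)) \<and>
      aas (\<lambda>n. post_process n (f n) (T n)) (\<lambda>n h. produces (induced_cycle_property n) h)"
    by blast
qed

end
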